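(* There is a constant $C$ such that for all $n\ge 1$, $q(n;\mathit{trees})\ge\log^*n-\log^*\log^*n-C$.
   Context: The tower function is $T(0)=1$, $T(i)=2^{T(i-1)}$; $\log^* n=\min\{i: T(i)\ge n\}$. Graphs are simple undirected graphs viewed as structures for the first-order language with adjacency symbol $\sim$ and equality. A sentence defines a finite graph $G$ if it is true on $G$ and false on every graph (of any cardinality) not isomorphic to $G$; $D(G)$ is the minimum quantifier rank of a sentence defining $G$. $q(n;\mathit{trees})=\min\{D(T): T\text{ a tree with } n\text{ vertices}\}$. *)

theory Defs
  imports Complex_Main
begin

fun tower :: "nat \<Rightarrow> nat" where
  "tower 0 = 1"
| "tower (Suc i) = 2 ^ tower i"

definition log_star :: "nat \<Rightarrow> nat" where
  "log_star n = (LEAST i. tower i \<ge> n)"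

datatype fo =
    Adj nat nat
  | Eq nat nat
  | Neg fo
  | Conj fo fo
  | Ex nat fo

fun qr :: "fo \<Rightarrow> nat" where
  "qr (Adj x y) = 0"
| "qr (Eq x y) = 0"
| "qr (Neg p) = qr p"
| "qr (Conj p q) = max (qr p) (qr q)"
| "qr (Ex x p) = Suc (qr p)"

fun fv :: "fo \<Rightarrow> nat set" where
  "fv (Adj x y) = {x, y}"
| "fv (Eq x y) = {x, y}"
| "fv (Neg p) = fv p"
| "fv (Conj p q) = fv p \<union> fv q"
| "fv (Ex x p) = fv p - {x}"

definition sentence :: "fo \<Rightarrow> bool" where
  "sentence p \<longleftrightarrow> fv p = {}"

fun sat :: "'a set \<Rightarrow> ('a \<Rightarrow> 'a \<Rightarrow> bool) \<Rightarrow> (nat \<Rightarrow> 'a) \<Rightarrow> fo \<Rightarrow> bool" where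
  "sat V E s (Adj x y) = E (s x) (s y)"
| "sat V E s (Eq x y) = (s x = s y)"
| "sat V E s (Neg p) = (\<not> sat V E s p)"
| "sat V E s (Conj p q) = (sat V E s p \<and> sat V E s q)"
| "sat V E s (Ex x p) = (\<exists>v\<in>V. sat V E (s(x := v)) p)"

definition models :: "'a set \<Rightarrow> ('a \<Rightarrow> 'a \<Rightarrow> bool) \<Rightarrow> fo \<Rightarrow> bool" where
  "models V E p \<longleftrightarrow> (\<forall>s. (\<forall>i. s i \<in> V) \<longrightarrow> sat V E s p)"

(* A simple undirected graph (nonempty vertex set, as usual for structures);
   the vertex set may be infinite. *)
definition is_graph :: "'a set \<Rightarrow> ('a \<Rightarrow> 'a \<Rightarrow> bool) \<Rightarrow> bool" where
  "is_graph V E \<longleftrightarrow> V \<noteq> {} \<and> (\<forall>x y. E x y \<longrightarrow> x \<in> V \<and> y \<in> V)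
     \<and> (\<forall>x y. E x y \<longrightarrow> E y x) \<and> (\<forall>x. \<not> E x x)"

definition graph_iso :: "'a set \<Rightarrow> ('a \<Rightarrow> 'a \<Rightarrow> bool) \<Rightarrow> 'b set \<Rightarrow> ('b \<Rightarrow> 'b \<Rightarrow> bool) \<Rightarrow> bool" where
  "graph_iso V E V' E' \<longleftrightarrow>
     (\<exists>f. bij_betw f V V' \<and> (\<forall>x\<in>V. \<forall>y\<in>V. E x y \<longleftrightarrow> E' (f x) (f y)))"

(* A sentence defines_graph G if it holds in G and fails in every graph not isomorphic to G.
   Graphs are taken with vertex sets of natural numbers (all countable graphs);
   by downward Loewenheim-Skolem this is equivalent to ranging over graphs of
   arbitrary cardinality. *)
definition defines_graph :: "'a set \<Rightarrow> ('a \<Rightarrow> 'a \<Rightarrow> bool) \<Rightarrow> fo \<Rightarrow> bool" where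
  "defines_graph V E p \<longleftrightarrow> sentence p \<and> models V E p \<and>
     (\<forall>(V' :: nat set) E'. is_graph V' E' \<and> models V' E' p \<longrightarrow> graph_iso V E V' E')"

definition D :: "'a set \<Rightarrow> ('a \<Rightarrow> 'a \<Rightarrow> bool) \<Rightarrow> nat" where
  "D V E = (LEAST k. \<exists>p. qr p = k \<and> defines_graph V E p)"

definition connected_graph :: "'a set \<Rightarrow> ('a \<Rightarrow> 'a \<Rightarrow> bool) \<Rightarrow> bool" where
  "connected_graph V E \<longleftrightarrow> (\<forall>x\<in>V. \<forall>y\<in>V. E\<^sup>*\<^sup>* x y)"

definition has_cycle :: "'a set \<Rightarrow> ('a \<Rightarrow> 'a \<Rightarrow> bool) \<Rightarrow> bool" where
  "has_cycle V E \<longleftrightarrow> (\<exists>vs. length vs \<ge> 3 \<and> distinct vs \<and> set vs \<subseteq> V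
     \<and> (\<forall>i. Suc i < length vs \<longrightarrow> E (vs ! i) (vs ! Suc i))
     \<and> E (last vs) (hd vs))"

definition is_tree :: "'a set \<Rightarrow> ('a \<Rightarrow> 'a \<Rightarrow> bool) \<Rightarrow> bool" where
  "is_tree V E \<longleftrightarrow> is_graph V E \<and> finite V \<and> connected_graph V E \<and> \<not> has_cycle V E"

(* q(n; trees): minimum of D(T) over trees T with n vertices
   (every such tree is isomorphic to one with vertex set of naturals) *)
definition q_trees :: "nat \<Rightarrow> nat" where
  "q_trees n = (INF VE \<in> {(V :: nat set, E). is_tree V E \<and> card V = n}. D (fst VE) (snd VE))"

end

theory Submission
  imports Defs "HOL-Library.Nat_Bijection"
begin

text \<open>Let a sentence of rank \<open>k\<close> define the tree \<open>T\<close>. Call a rooted subtree \<open>(A, a)\<close> pendant if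
  only \<open>a\<close> has neighbours outside \<open>A\<close>. If \<open>(A, a)\<close> is pendant and some \<open>(B, b)\<close> with \<open>B\<close> a proper
  subset of \<open>A\<close> has the same rank-\<open>k\<close> Ehrenfeucht type, then replacing \<open>A\<close> by \<open>B\<close> gives a smaller
  graph that satisfies the sentence, which is impossible. Cutting an edge at \<open>a\<close> splits a pendant
  subtree into two, and passing to the larger half each time yields a descending chain of about
  \<open>log n\<close> pendant subtrees, all of distinct types. Hence \<open>n\<close> is less than 2 to the number of
  rank-\<open>k\<close> types of one vertex, and that number is an exponential tower of height \<open>k + 1\<close> over a
  quadratic polynomial in \<open>k\<close>.\<close>

section \<open>Ehrenfeucht--Fraisse types\<close>

text \<open>Types are coded as numbers so that structures over different vertex types compare by
  equality and a numeric bound counts the types. At rank 0, even codes record adjacencies and odd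
  codes equalities; moves are prepended.\<close>

fun ef_type :: "nat \<Rightarrow> 'a set \<Rightarrow> ('a \<Rightarrow> 'a \<Rightarrow> bool) \<Rightarrow> 'a list \<Rightarrow> nat" where
  "ef_type 0 V E xs = set_encode
     ({2 * prod_encode (i, j) |i j. i < length xs \<and> j < length xs \<and> E (xs ! i) (xs ! j)} \<union>
      {Suc (2 * prod_encode (i, j)) |i j. i < length xs \<and> j < length xs \<and> xs ! i = xs ! j})"
| "ef_type (Suc k) V E xs = set_encode ((\<lambda>v. ef_type k V E (v # xs)) ` V)"

lemma set_encode_less_power:
  assumes "S \<subseteq> {..<N}"
  shows "set_encode S < 2 ^ N"
proof -
  have "set_encode S \<le> (\<Sum>i<N. 2 ^ i)"
    unfolding set_encode_def using assms by (intro sum_mono2) auto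
  also have "\<dots> < 2 ^ N"
    by (simp add: lessThan_atLeast0 sum_power2)
  finally show ?thesis .
qed

lemma prod_encode_less:
  assumes "i < m" "j < m"
  shows "prod_encode (i, j) < 4 * m\<^sup>2"
proof -
  obtain d where d: "m = Suc d" using assms(1) by (cases m) auto
  have ij: "i + j \<le> 2 * d" "i \<le> d" using assms d by auto
  have "prod_encode (i, j) \<le> (i + j) * Suc (i + j) + i"
    by (simp add: prod_encode_def triangle_def)
  also have "\<dots> \<le> (2 * d) * Suc (2 * d) + d"
    using ij by (intro add_mono mult_mono) auto
  also have "\<dots> < 4 * m\<^sup>2"
    by (simp add: d power2_eq_square)
  finally show ?thesis .
qed

lemma ef_type_atoms_subset:
  "{2 * prod_encode (i, j) |i j. i < m \<and> j < m \<and> P i j} \<union>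
   {Suc (2 * prod_encode (i, j)) |i j. i < m \<and> j < m \<and> Q i j} \<subseteq> {..<8 * m\<^sup>2}"
proof -
  have "2 * prod_encode (i, j) < 8 * m\<^sup>2 \<and> Suc (2 * prod_encode (i, j)) < 8 * m\<^sup>2"
    if "i < m" "j < m" for i j
    using prod_encode_less[OF that] by linarith
  then show ?thesis by auto
qed

text \<open>A rank \<open>Suc k\<close> type is a set of rank \<open>k\<close> types, which costs
  one exponential. A move lengthens the list by one and uses up one round, so
  \<open>length xs + k\<close>, and with it the base of the tower, stays fixed.\<close>

lemma ef_type_less:
  "ef_type k V E xs < ((\<lambda>x. 2 ^ x) ^^ Suc k) (8 * (length xs + k)\<^sup>2)"
proof (induction k arbitrary: xs)
  case 0
  show ?case
    using set_encode_less_power[OF ef_type_atoms_subset] by simp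
next
  case (Suc k)
  have "(\<lambda>v. ef_type k V E (v # xs)) ` V \<subseteq> {..<((\<lambda>x. 2 ^ x) ^^ Suc k) (8 * (length xs + Suc k)\<^sup>2)}"
    using Suc[of "_ # xs"] by (auto simp del: funpow.simps)
  from set_encode_less_power[OF this] show ?case by simp
qed

text \<open>\<open>set_encode\<close> is injective only on finite sets. Although \<open>V\<close>
  may be infinite, the previous bound leaves finitely many types.\<close>

lemma finite_ef_type_image: "finite ((\<lambda>v. ef_type k V E (v # xs)) ` V)"
proof (rule finite_subset)
  show "(\<lambda>v. ef_type k V E (v # xs)) ` V \<subseteq> {..<((\<lambda>x. 2 ^ x) ^^ Suc k) (8 * (Suc (length xs) + k)\<^sup>2)}"
    using ef_type_less[of k V E "_ # xs"] by (auto simp del: funpow.simps)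
qed simp

text \<open>Parity keeps the two kinds of atoms apart, and injectivity of \<open>prod_encode\<close>
  recovers the pair of indices.\<close>

lemma ef_type_0_eq_iff:
  assumes "length xs = length ys"
  shows "ef_type 0 V E xs = ef_type 0 W F ys \<longleftrightarrow>
    (\<forall>i<length xs. \<forall>j<length xs.
      (E (xs ! i) (xs ! j) \<longleftrightarrow> F (ys ! i) (ys ! j)) \<and> (xs ! i = xs ! j \<longleftrightarrow> ys ! i = ys ! j))"
proof -
  define m where "m = length xs"
  have m: "length ys = m" using assms m_def by simp
  define code where "code P Q =
    {2 * prod_encode (i, j) |i j. i < m \<and> j < m \<and> P i j} \<union>
    {Suc (2 * prod_encode (i, j)) |i j. i < m \<and> j < m \<and> Q i j}" for P Q
  have fin: "finite (code P Q)" for P Q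
    unfolding code_def by (rule finite_subset[OF ef_type_atoms_subset]) simp
  have edge: "2 * prod_encode (i, j) \<in> code P Q \<longleftrightarrow> P i j" if "i < m" "j < m" for i j P Q
    using that by (auto simp: code_def) presburger+
  have equal: "Suc (2 * prod_encode (i, j)) \<in> code P Q \<longleftrightarrow> Q i j" if "i < m" "j < m" for i j P Q
    using that by (auto simp: code_def) presburger+
  have "code P Q = code P' Q' \<longleftrightarrow> (\<forall>i<m. \<forall>j<m. (P i j \<longleftrightarrow> P' i j) \<and> (Q i j \<longleftrightarrow> Q' i j))"
    for P Q P' Q'
  proof
    assume "code P Q = code P' Q'"
    then show "\<forall>i<m. \<forall>j<m. (P i j \<longleftrightarrow> P' i j) \<and> (Q i j \<longleftrightarrow> Q' i j)"
      using edge equal by metis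
  next
    assume "\<forall>i<m. \<forall>j<m. (P i j \<longleftrightarrow> P' i j) \<and> (Q i j \<longleftrightarrow> Q' i j)"
    then show "code P Q = code P' Q'"
      unfolding code_def by (intro arg_cong2[where f = "(\<union>)"] Collect_cong) blast+
  qed
  then show ?thesis
    by (simp add: m m_def[symmetric] code_def[symmetric] set_encode_eq fin)
qed

text \<open>Equality of the two images of types is exactly the back-and-forth condition of the
  game.\<close>

lemma ef_type_Suc_eq_iff:
  "ef_type (Suc k) V E xs = ef_type (Suc k) W F ys \<longleftrightarrow>
    (\<forall>v\<in>V. \<exists>w\<in>W. ef_type k V E (v # xs) = ef_type k W F (w # ys)) \<and>
    (\<forall>w\<in>W. \<exists>v\<in>V. ef_type k V E (v # xs) = ef_type k W F (w # ys))"
proof -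
  have "(\<lambda>v. ef_type k V E (v # xs)) ` V = (\<lambda>w. ef_type k W F (w # ys)) ` W \<longleftrightarrow>
    (\<forall>v\<in>V. \<exists>w\<in>W. ef_type k V E (v # xs) = ef_type k W F (w # ys)) \<and>
    (\<forall>w\<in>W. \<exists>v\<in>V. ef_type k V E (v # xs) = ef_type k W F (w # ys))" (is "?f ` V = ?g ` W \<longleftrightarrow> ?R")
  proof
    assume eq: "?f ` V = ?g ` W"
    show ?R
    proof (intro conjI ballI)
      fix v assume "v \<in> V"
      then have "?f v \<in> ?g ` W" unfolding eq[symmetric] by simp
      then show "\<exists>w\<in>W. ?f v = ?g w" by auto
    next
      fix w assume "w \<in> W"
      then have "?g w \<in> ?f ` V" unfolding eq by simp
      then show "\<exists>v\<in>V. ?f v = ?g w" by auto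
    qed
  next
    assume ?R
    then show "?f ` V = ?g ` W" by (auto simp: image_iff) metis
  qed
  then show ?thesis by (simp add: set_encode_eq finite_ef_type_image)
qed

text \<open>Spoiler can waste the remaining rounds by replaying the legal move
  \<open>xs ! i\<close>. Old indices then shift by one, and rank 0 is reached with the atoms
  intact.\<close>

lemma ef_type_eq_imp_atoms_eq:
  assumes "ef_type k V E xs = ef_type k W F ys" "length xs = length ys" "set xs \<subseteq> V"
    and "i < length xs" "j < length xs"
  shows "(E (xs ! i) (xs ! j) \<longleftrightarrow> F (ys ! i) (ys ! j)) \<and> (xs ! i = xs ! j \<longleftrightarrow> ys ! i = ys ! j)"
  using assms
proof (induction k arbitrary: xs ys i j)
  case 0
  then show ?case using 0(1)[unfolded ef_type_0_eq_iff[OF 0(2)]] by simp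
next
  case (Suc k)
  then have "xs ! i \<in> V" by auto
  then obtain w where "ef_type k V E (xs ! i # xs) = ef_type k W F (w # ys)"
    using Suc.prems(1) unfolding ef_type_Suc_eq_iff by blast
  from Suc.IH[OF this, of "Suc i" "Suc j"] show ?case
    using Suc.prems \<open>xs ! i \<in> V\<close> by auto
qed

lemma ef_type_cong:
  assumes "\<And>x y. x \<in> V \<Longrightarrow> y \<in> V \<Longrightarrow> E x y \<longleftrightarrow> F x y" "set xs \<subseteq> V"
  shows "ef_type k V E xs = ef_type k V F xs"
  using assms(2)
proof (induction k arbitrary: xs)
  case 0
  then have "E (xs ! i) (xs ! j) \<longleftrightarrow> F (xs ! i) (xs ! j)" if "i < length xs" "j < length xs" for i j
    using that by (intro assms(1)) auto
  then show ?case unfolding ef_type_0_eq_iff[OF refl] by blast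
next
  case (Suc k)
  have "(\<lambda>v. ef_type k V E (v # xs)) ` V = (\<lambda>v. ef_type k V F (v # xs)) ` V"
    using Suc by (intro image_cong) auto
  then show ?case by simp
qed

text \<open>A quantifier spends one round: the witness and its answer enter at index 0 and the other
  free variables shift by one.\<close>

lemma sat_eq_of_ef_type_eq:
  assumes "ef_type k V E xs = ef_type k W F ys" "length xs = length ys" "set xs \<subseteq> V" "qr p \<le> k"
    and "\<And>x. x \<in> fv p \<Longrightarrow> \<exists>i<length xs. s x = xs ! i \<and> t x = ys ! i"
  shows "sat V E s p \<longleftrightarrow> sat W F t p"
  using assms
proof (induction p arbitrary: k xs ys s t)
  case (Adj x y)
  obtain i j where "i < length xs" "s x = xs ! i" "t x = ys ! i"
    "j < length xs" "s y = xs ! j" "t y = ys ! j"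
    using Adj.prems(5)[of x] Adj.prems(5)[of y] by auto
  then show ?case using ef_type_eq_imp_atoms_eq[OF Adj.prems(1-3), of i j] by simp
next
  case (Eq x y)
  obtain i j where "i < length xs" "s x = xs ! i" "t x = ys ! i"
    "j < length xs" "s y = xs ! j" "t y = ys ! j"
    using Eq.prems(5)[of x] Eq.prems(5)[of y] by auto
  then show ?case using ef_type_eq_imp_atoms_eq[OF Eq.prems(1-3), of i j] by simp
next
  case (Neg p)
  have "sat V E s p \<longleftrightarrow> sat W F t p"
    using Neg.prems(4,5) by (intro Neg.IH[OF Neg.prems(1-3)]) auto
  then show ?case by simp
next
  case (Conj p q)
  have "sat V E s p \<longleftrightarrow> sat W F t p" "sat V E s q \<longleftrightarrow> sat W F t q"
    using Conj.prems(4,5) by (auto intro!: Conj.IH[OF Conj.prems(1-3)])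
  then show ?case by simp
next
  case (Ex x p)
  then obtain j where k: "k = Suc j" by (cases k) auto
  have IH: "sat V E (s(x := v)) p \<longleftrightarrow> sat W F (t(x := w)) p"
    if "v \<in> V" "ef_type j V E (v # xs) = ef_type j W F (w # ys)" for v w
  proof (rule Ex.IH[OF that(2)])
    show "length (v # xs) = length (w # ys)" "set (v # xs) \<subseteq> V" "qr p \<le> j"
      using Ex.prems k that by auto
    fix y assume y: "y \<in> fv p"
    show "\<exists>i<length (v # xs). (s(x := v)) y = (v # xs) ! i \<and> (t(x := w)) y = (w # ys) ! i"
    proof (cases "y = x")
      case True
      then show ?thesis by (intro exI[of _ 0]) simp
    next
      case False
      then obtain i where "i < length xs" "s y = xs ! i" "t y = ys ! i"
        using Ex.prems(5)[of y] y by auto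
      then show ?thesis using False by (intro exI[of _ "Suc i"]) simp
    qed
  qed
  note step = Ex.prems(1)[unfolded k ef_type_Suc_eq_iff]
  show ?case
  proof
    assume "sat V E s (Ex x p)"
    then obtain v where v: "v \<in> V" "sat V E (s(x := v)) p" by auto
    then obtain w where "w \<in> W" "ef_type j V E (v # xs) = ef_type j W F (w # ys)"
      using step by blast
    then show "sat W F t (Ex x p)" using IH v by auto
  next
    assume "sat W F t (Ex x p)"
    then obtain w where w: "w \<in> W" "sat W F (t(x := w)) p" by auto
    then obtain v where "v \<in> V" "ef_type j V E (v # xs) = ef_type j W F (w # ys)"
      using step by blast
    then show "sat V E s (Ex x p)" using IH w by auto
  qed
qed

section \<open>Composing games along a root vertex\<close>

definition glued where
  "glued R A a E B b F N \<longleftrightarrow> R \<inter> A = {} \<and> R \<inter> B = {} \<and>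
    (\<forall>x\<in>R. \<forall>y\<in>R. E x y \<longleftrightarrow> F x y) \<and>
    (\<forall>x\<in>R. \<forall>y\<in>A. (E x y \<longleftrightarrow> y = a \<and> x \<in> N) \<and> (E y x \<longleftrightarrow> y = a \<and> x \<in> N)) \<and>
    (\<forall>x\<in>R. \<forall>y\<in>B. (F x y \<longleftrightarrow> y = b \<and> x \<in> N) \<and> (F y x \<longleftrightarrow> y = b \<and> x \<in> N))"

text \<open>\<open>xs, xs'\<close> is a position of the game on the whole structures and \<open>ys, ys'\<close> an auxiliary
  position on \<open>(A, a)\<close> against \<open>(B, b)\<close> that accounts for every move outside \<open>R\<close>.\<close>

definition covers where
  "covers R a b xs xs' ys ys' \<longleftrightarrow> length xs = length xs' \<and> length ys = length ys' \<and>
    (a, b) \<in> set (zip ys ys') \<and> set (zip xs xs') \<subseteq> Id_on R \<union> set (zip ys ys')"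

lemma covers_grow: "covers R a b xs xs' ys ys' \<Longrightarrow> covers R a b xs xs' (v # ys) (w # ys')"
  unfolding covers_def by auto

lemma covers_Cons_left: "covers R a b xs xs' ys ys' \<Longrightarrow> v \<in> R \<Longrightarrow> covers R a b (v # xs) (v # xs') ys ys'"
  unfolding covers_def by auto

lemma covers_Cons_right:
  "covers R a b xs xs' ys ys' \<Longrightarrow> covers R a b (v # xs) (w # xs') (v # ys) (w # ys')"
  unfolding covers_def by auto

lemma covers_nth:
  assumes "covers R a b xs xs' ys ys'" "i < length xs"
  obtains "xs ! i = xs' ! i" "xs ! i \<in> R"
    | m where "m < length ys" "xs ! i = ys ! m" "xs' ! i = ys' ! m"
proof -
  have "(xs ! i, xs' ! i) \<in> set (zip xs xs')"
    using assms by (auto simp: covers_def in_set_zip)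
  then have "(xs ! i, xs' ! i) \<in> Id_on R \<union> set (zip ys ys')"
    using assms(1) unfolding covers_def by blast
  then show thesis
    using that by (auto simp: in_set_zip Id_on_iff)
qed

text \<open>Duplicator copies moves in the common part and follows a winning strategy on
  \<^term>\<open>(A, a)\<close> against \<^term>\<open>(B, b)\<close> otherwise.\<close>

lemma ef_type_glued:
  assumes "glued R A a E B b F N" "a \<in> A" "b \<in> B" "covers R a b xs xs' ys ys'"
    and "ef_type k A E ys = ef_type k B F ys'" "set ys \<subseteq> A" "set ys' \<subseteq> B"
  shows "ef_type k (R \<union> A) E xs = ef_type k (R \<union> B) F xs'"
  using assms(4-)
proof (induction k arbitrary: xs xs' ys ys')
  case 0
  have len: "length xs = length xs'" "length ys = length ys'"
    using 0(1) by (auto simp: covers_def)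
  obtain l where l: "l < length ys" "ys ! l = a" "ys' ! l = b"
    using 0(1) by (auto simp: covers_def in_set_zip)
  note atoms = ef_type_eq_imp_atoms_eq[OF 0(2) len(2) 0(3)]
  have in_AB: "ys ! m \<in> A" "ys' ! m \<in> B" if "m < length ys" for m
    using that 0(3,4) len by auto
  \<comment> \<open>The pair \<open>(a, b)\<close> belongs to the auxiliary position, so its
    equality atoms preserve being the root. Adjacency to \<open>R\<close> depends on nothing else,
    since both roots are attached through the same set \<open>N\<close>.\<close>
  have root: "ys ! m = a \<longleftrightarrow> ys' ! m = b" if "m < length ys" for m
    using atoms[OF that l(1)] l by simp
  have R: "E x y \<longleftrightarrow> F x y" if "x \<in> R" "y \<in> R" for x y
    using that assms(1) unfolding glued_def by blast
  have RY: "(E x (ys ! m) \<longleftrightarrow> F x (ys' ! m)) \<and> (E (ys ! m) x \<longleftrightarrow> F (ys' ! m) x) \<and> x \<noteq> ys ! m \<and> x \<noteq> ys' ! m"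
    if "x \<in> R" "m < length ys" for x m
    using that in_AB[of m] root[of m] assms(1) unfolding glued_def by blast
  have "(E (xs ! i) (xs ! j) \<longleftrightarrow> F (xs' ! i) (xs' ! j)) \<and> (xs ! i = xs ! j \<longleftrightarrow> xs' ! i = xs' ! j)"
    if ij: "i < length xs" "j < length xs" for i j
    using 0(1) ij(1)
  proof (cases rule: covers_nth)
    case i: 1
    from 0(1) ij(2) show ?thesis
    proof (cases rule: covers_nth)
      case 1
      then show ?thesis using i R by simp
    next
      case (2 m)
      then show ?thesis using i RY[of "xs ! i" m] by auto
    qed
  next
    case i: (2 m)
    from 0(1) ij(2) show ?thesis
    proof (cases rule: covers_nth)
      case 1
      then show ?thesis using i RY[of "xs ! j" m] by auto
    next
      case (2 m')
      then show ?thesis using i atoms by simp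
    qed
  qed
  then show ?case unfolding ef_type_0_eq_iff[OF len(1)] by simp
next
  case (Suc k)
  note step = Suc.prems(2)[unfolded ef_type_Suc_eq_iff]
  \<comment> \<open>A move inside \<open>R\<close> must also use up a round of the auxiliary game.
    There \<open>a\<close> is played as padding, and any valid answer \<open>w\<close> will
    do.\<close>
  obtain w where w: "w \<in> B" "ef_type k A E (a # ys) = ef_type k B F (w # ys')"
    using step assms(2) by blast
  have common: "ef_type k (R \<union> A) E (v # xs) = ef_type k (R \<union> B) F (v # xs')" if "v \<in> R" for v
    by (rule Suc.IH[OF covers_Cons_left[OF covers_grow[OF Suc.prems(1)] that] w(2)])
      (use Suc.prems assms w in auto)
  have follow: "ef_type k (R \<union> A) E (v # xs) = ef_type k (R \<union> B) F (w # xs')"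
    if "v \<in> A" "w \<in> B" "ef_type k A E (v # ys) = ef_type k B F (w # ys')" for v w
    by (rule Suc.IH[OF covers_Cons_right[OF Suc.prems(1)] that(3)]) (use Suc.prems that in auto)
  show ?case
    unfolding ef_type_Suc_eq_iff
  proof (intro conjI ballI)
    fix v assume "v \<in> R \<union> A"
    then show "\<exists>w\<in>R \<union> B. ef_type k (R \<union> A) E (v # xs) = ef_type k (R \<union> B) F (w # xs')"
      using common[of v] follow[of v] step by blast
  next
    fix w assume "w \<in> R \<union> B"
    then show "\<exists>v\<in>R \<union> A. ef_type k (R \<union> A) E (v # xs) = ef_type k (R \<union> B) F (w # xs')"
      using common[of w] follow[of _ w] step by blast
  qed
qed

section \<open>Shrinking a graph at a cut\<close>

lemma graph_iso_card: "graph_iso V E W F \<Longrightarrow> card V = card W"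
  unfolding graph_iso_def using bij_betw_same_card by blast

text \<open>Vertices are natural numbers here so that the shrunken graph lies in the range of the
  quantifier in \<open>defines_graph\<close>.\<close>

lemma defines_graph_imp_ef_type_neq:
  fixes V :: "nat set"
  assumes G: "is_graph V E" "finite V" and p: "defines_graph V E p" "qr p \<le> k"
    and A: "A \<subseteq> V" "a \<in> A" "\<And>x y. x \<in> V - A \<Longrightarrow> y \<in> A \<Longrightarrow> E x y \<Longrightarrow> y = a"
    and B: "B \<subset> A" "b \<in> B"
  shows "ef_type k A E [a] \<noteq> ef_type k B E [b]"
proof
  assume same: "ef_type k A E [a] = ef_type k B E [b]"
  \<comment> \<open>\<open>F\<close> keeps \<open>E\<close> within \<open>R\<close> and within
    \<open>B\<close>, and reattaches to \<open>b\<close> the neighbours of \<open>a\<close> in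
    \<open>R\<close>.\<close>
  define R W F where "R = V - A" and "W = R \<union> B"
    and "F x y \<longleftrightarrow> x \<in> R \<and> y \<in> R \<and> E x y \<or> x \<in> B \<and> y \<in> B \<and> E x y \<or>
      x \<in> R \<and> y = b \<and> E x a \<or> x = b \<and> y \<in> R \<and> E y a" for x y
  have V: "V = R \<union> A" using A by (auto simp: R_def)
  have sym: "E x y \<longleftrightarrow> E y x" for x y using G(1) unfolding is_graph_def by blast
  have disj: "x \<notin> A" "x \<notin> B" if "x \<in> R" for x using that B by (auto simp: R_def)
  have FB: "F x y \<longleftrightarrow> E x y" if "x \<in> B" "y \<in> B" for x y
    using that disj unfolding F_def by blast
  have cut: "E x y \<longleftrightarrow> y = a \<and> E x a" if "x \<in> R" "y \<in> A" for x y
    using that A(3)[of x y] unfolding R_def by blast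
  have "ef_type k B E [b] = ef_type k B F [b]"
    using FB B by (intro ef_type_cong) auto
  then have same: "ef_type k A E [a] = ef_type k B F [b]"
    using same by simp
  have "glued R A a E B b F {x \<in> R. E x a}"
    unfolding glued_def
  proof (intro conjI ballI)
    show "R \<inter> A = {}" "R \<inter> B = {}" using disj by auto
    show "E x y \<longleftrightarrow> F x y" if "x \<in> R" "y \<in> R" for x y
      using that disj B unfolding F_def by blast
    show "E x y \<longleftrightarrow> y = a \<and> x \<in> {x \<in> R. E x a}" "E y x \<longleftrightarrow> y = a \<and> x \<in> {x \<in> R. E x a}"
      if "x \<in> R" "y \<in> A" for x y
      using that cut sym by blast+
    show "F x y \<longleftrightarrow> y = b \<and> x \<in> {x \<in> R. E x a}" "F y x \<longleftrightarrow> y = b \<and> x \<in> {x \<in> R. E x a}"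
      if "x \<in> R" "y \<in> B" for x y
      using that disj B unfolding F_def by blast+
  qed
  \<comment> \<open>The whole game starts from the empty position, while the auxiliary position
    already holds the two roots.\<close>
  then have "ef_type k (R \<union> A) E [] = ef_type k (R \<union> B) F []"
    using same A B by (intro ef_type_glued[of R A a E B b F _ _ _ "[a]" "[b]"])
      (auto simp: covers_def)
  then have eq: "ef_type k V E [] = ef_type k W F []" by (simp add: V W_def)
  have "models W F p"
    unfolding models_def
  proof (intro allI impI)
    fix t :: "nat \<Rightarrow> nat"
    have "sat V E (\<lambda>_. a) p"
      using p(1) A(1,2) unfolding defines_graph_def models_def by auto
    then show "sat W F t p"
      using sat_eq_of_ef_type_eq[OF eq _ _ p(2), of "\<lambda>_. a" t] p(1)
      by (simp add: defines_graph_def sentence_def)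
  qed
  moreover have "is_graph W F"
    unfolding is_graph_def
  proof (intro conjI allI impI)
    show "W \<noteq> {}" using B by (auto simp: W_def)
    show "x \<in> W" "y \<in> W" if "F x y" for x y
      using that B unfolding F_def W_def by blast+
    show "F y x" if "F x y" for x y
      using that sym unfolding F_def by blast
    show "\<not> F x x" for x
      using G(1) disj B unfolding F_def is_graph_def by blast
  qed
  ultimately have "card V = card W"
    using p(1) graph_iso_card unfolding defines_graph_def by blast
  moreover have "card W < card V"
    using G(2) A B by (intro psubset_card_mono) (auto simp: W_def R_def)
  ultimately show False by simp
qed

section \<open>Splitting a tree along an edge\<close>

text \<open>Paths must stay inside \<open>A\<close>: this is connectedness of the induced subgraph,
  with the root carried along as its point of attachment.\<close>

definition connected_in :: "'a set \<Rightarrow> ('a \<Rightarrow> 'a \<Rightarrow> bool) \<Rightarrow> 'a \<Rightarrow> bool" where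
  "connected_in A E a \<longleftrightarrow> a \<in> A \<and> (\<forall>x\<in>A. (\<lambda>u v. u \<in> A \<and> v \<in> A \<and> E u v)\<^sup>*\<^sup>* a x)"

lemma rtranclp_imp_distinct_path:
  assumes "R\<^sup>*\<^sup>* x y"
  obtains vs where "vs \<noteq> []" "hd vs = x" "last vs = y" "distinct vs"
    "\<And>i. Suc i < length vs \<Longrightarrow> R (vs ! i) (vs ! Suc i)"
proof -
  have "\<exists>vs. vs \<noteq> [] \<and> hd vs = x \<and> last vs = y \<and> distinct vs \<and> successively R vs"
    using assms
  proof induction
    case base
    then show ?case by (intro exI[of _ "[x]"]) simp
  next
    case (step y z)
    then obtain vs where vs: "vs \<noteq> []" "hd vs = x" "last vs = y" "distinct vs" "successively R vs"
      by blast
    show ?case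
    proof (cases "z \<in> set vs")
      \<comment> \<open>Returning to a visited vertex closes a loop; cutting the list at the earlier
        occurrence deletes it.\<close>
      case True
      then obtain us ws where "vs = us @ z # ws" by (meson split_list)
      with vs show ?thesis
        by (intro exI[of _ "us @ [z]"]) (auto simp: hd_append successively_append_iff)
    next
      case False
      with vs step(2) show ?thesis
        by (intro exI[of _ "vs @ [z]"]) (auto simp: successively_append_iff)
    qed
  qed
  then show thesis using that by (auto simp: successively_conv_nth)
qed

text \<open>Such a path would close up to a cycle with the edge from \<open>a\<close> to
  \<open>c\<close>. The three vertices that \<open>has_cycle\<close> demands come from
  \<open>a \<noteq> c\<close>, excluding length 1, and from the failure of \<open>R c a\<close>,
  excluding length 2.\<close>

lemma no_path_avoiding_edge:
  assumes "\<not> has_cycle V E" "E a c" "a \<noteq> c" "c \<in> V"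
    and R: "\<And>x y. R x y \<Longrightarrow> E x y \<and> y \<in> V" "\<not> R c a"
  shows "\<not> R\<^sup>*\<^sup>* c a"
proof
  assume "R\<^sup>*\<^sup>* c a"
  then obtain vs where vs: "vs \<noteq> []" "hd vs = c" "last vs = a" "distinct vs"
    and step: "\<And>i. Suc i < length vs \<Longrightarrow> R (vs ! i) (vs ! Suc i)"
    by (rule rtranclp_imp_distinct_path) blast
  have "length vs \<noteq> 1" using vs assms(3) by (auto simp: length_Suc_conv)
  moreover have "length vs \<noteq> 2"
  proof
    assume l: "length vs = 2"
    then have "R (vs ! 0) (vs ! 1)" using step[of 0] by simp
    then show False using l vs R(2) by (simp add: hd_conv_nth last_conv_nth)
  qed
  moreover have "length vs \<noteq> 0" using vs(1) by simp
  ultimately have "length vs \<ge> 3" by linarith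
  moreover have "vs ! i \<in> V" if "i < length vs" for i
  proof (cases i)
    case 0
    then show ?thesis using vs assms(4) by (simp add: hd_conv_nth)
  next
    case (Suc j)
    then show ?thesis using R(1)[OF step[of j]] that by simp
  qed
  then have "set vs \<subseteq> V" by (auto simp: in_set_conv_nth)
  ultimately have "has_cycle V E"
    using vs step R(1) assms(2) unfolding has_cycle_def by metis
  then show False using assms(1) by simp
qed

text \<open>Delete an edge from \<open>a\<close> to a neighbour \<open>c\<close> and let
  \<open>B\<close> be the component of \<open>c\<close>. By acyclicity \<open>a\<close> falls
  outside it.\<close>

lemma connected_in_split:
  assumes G: "is_graph V E" "\<not> has_cycle V E" "A \<subseteq> V"
    and A: "connected_in A E a" "A \<noteq> {a}"
  obtains c B where "B \<subseteq> A" "connected_in (A - B) E a" "connected_in B E c"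
    "\<And>x y. x \<in> A - B \<Longrightarrow> y \<in> B \<Longrightarrow> E x y \<Longrightarrow> x = a \<and> y = c"
proof -
  have sym: "E x y \<Longrightarrow> E y x" and irr: "\<not> E x x" for x y
    using G(1) unfolding is_graph_def by blast+
  let ?A = "\<lambda>u v. u \<in> A \<and> v \<in> A \<and> E u v"
  obtain d where "d \<in> A" "d \<noteq> a" using A unfolding connected_in_def by blast
  then have "?A\<^sup>*\<^sup>* a d" using A(1) unfolding connected_in_def by blast
  then obtain c where c: "c \<in> A" "E a c" "a \<in> A"
    using \<open>d \<noteq> a\<close> by (auto elim: converse_rtranclpE)
  \<comment> \<open>Comparing unordered pairs deletes the edge in both directions.\<close>
  define R where "R u v \<longleftrightarrow> ?A u v \<and> {u, v} \<noteq> {a, c}" for u v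
  define B where "B = {x. R\<^sup>*\<^sup>* c x}"
  have B_sub: "B \<subseteq> A"
  proof
    fix x assume "x \<in> B"
    then have "R\<^sup>*\<^sup>* c x" by (simp add: B_def)
    then show "x \<in> A" by cases (use c in \<open>auto simp: R_def\<close>)
  qed
  have "\<not> R\<^sup>*\<^sup>* c a"
    by (rule no_path_avoiding_edge[OF G(2) c(2)]) (use c irr G(3) in \<open>auto simp: R_def\<close>)
  then have aB: "a \<notin> B" by (simp add: B_def)
  have cB: "c \<in> B" by (simp add: B_def)
  have cut: "x = a \<and> y = c" if "x \<in> A - B" "y \<in> B" "E x y" for x y
  proof (rule ccontr)
    assume "\<not> (x = a \<and> y = c)"
    then have "{y, x} \<noteq> {a, c}" using that aB by (auto simp: doubleton_eq_iff)
    then have "R y x" using that B_sub sym by (auto simp: R_def)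
    then have "x \<in> B" using that(2) unfolding B_def by (auto intro: rtranclp.rtrancl_into_rtrancl)
    then show False using that by simp
  qed
  have "(\<lambda>u v. u \<in> B \<and> v \<in> B \<and> E u v)\<^sup>*\<^sup>* c x" if "x \<in> B" for x
  proof -
    from that have "R\<^sup>*\<^sup>* c x" by (simp add: B_def)
    then have "(\<lambda>u v. u \<in> B \<and> v \<in> B \<and> E u v)\<^sup>*\<^sup>* c x \<and> x \<in> B"
    proof induction
      case base
      then show ?case using cB by simp
    next
      case (step y z)
      then have "z \<in> B" unfolding B_def by (auto intro: rtranclp.rtrancl_into_rtrancl)
      then show ?case using step by (auto simp: R_def intro: rtranclp.rtrancl_into_rtrancl)
    qed
    then show ?thesis ..
  qed
  then have B_conn: "connected_in B E c" using cB by (simp add: connected_in_def)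
  let ?C = "\<lambda>u v. u \<in> A - B \<and> v \<in> A - B \<and> E u v"
  have "?C\<^sup>*\<^sup>* a x" if "x \<in> A - B" for x
  proof -
    have "?A\<^sup>*\<^sup>* a x" using A(1) that unfolding connected_in_def by blast
    \<comment> \<open>A path in \<open>A\<close> can step out of \<open>B\<close> only to
      \<open>a\<close>, where the path outside \<open>B\<close> starts afresh. Hence the disjunction
      is preserved along the path.\<close>
    then have "x \<in> B \<or> ?C\<^sup>*\<^sup>* a x"
    proof induction
      case base
      then show ?case by simp
    next
      case (step y z)
      show ?case
      proof (cases "z \<in> B \<or> z = a")
        case False
        then have "y \<notin> B" using step(2) cut[of z y] sym by auto
        then have "?C\<^sup>*\<^sup>* a y" "?C y z" using step False by auto
        then show ?thesis by (auto intro: rtranclp.rtrancl_into_rtrancl)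
      qed auto
    qed
    then show ?thesis using that by simp
  qed
  then have "connected_in (A - B) E a" using c aB by (simp add: connected_in_def)
  from that[OF B_sub this B_conn cut] show thesis .
qed

section \<open>Counting types bounds the order of a tree\<close>

lemma tree_card_less:
  fixes V :: "nat set"
  assumes T: "is_tree V E" and p: "defines_graph V E p" "qr p \<le> k"
  shows "card V < ((\<lambda>x. 2 ^ x) ^^ Suc (Suc k)) (8 * (Suc k)\<^sup>2)"
proof -
  have G: "is_graph V E" "finite V" "\<not> has_cycle V E" using T unfolding is_tree_def by auto
  have sym: "E x y \<longleftrightarrow> E y x" for x y using G(1) unfolding is_graph_def by blast
  define types where "types A = {ef_type k B E [b] |B b. B \<subseteq> A \<and> b \<in> B}" for A
  \<comment> \<open>A single root is listed, so \<open>length xs + k\<close> is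
    \<open>Suc k\<close>.\<close>
  let ?N = "((\<lambda>x. 2 ^ x) ^^ Suc k) (8 * (Suc k)\<^sup>2) :: nat"
  have types_sub: "types A \<subseteq> {..<?N}" for A
    using ef_type_less[of k _ E "[_]"] by (auto simp: types_def simp del: funpow.simps)
  then have fin: "finite (types A)" for A by (rule finite_subset) simp
  \<comment> \<open>The descending chain becomes an induction on pendant subtrees. Neither half
    contains the type of \<open>(A, a)\<close> among its types, so each bound is at most half of the
    bound for \<open>A\<close>, and the two add up.\<close>
  have small: "card A < 2 ^ card (types A)"
    if "finite A" "A \<subseteq> V" "connected_in A E a" "\<And>x y. x \<in> V - A \<Longrightarrow> y \<in> A \<Longrightarrow> E x y \<Longrightarrow> y = a" for A a
    using that
  proof (induction A arbitrary: a rule: finite_psubset_induct)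
    case (psubset A)
    have a: "a \<in> A" using psubset.prems(2) by (simp add: connected_in_def)
    have own: "ef_type k A E [a] \<in> types A" using a by (auto simp: types_def)
    show ?case
    proof (cases "A = {a}")
      case True
      have "card (types A) \<noteq> 0" using own fin by auto
      then show ?thesis using True one_less_power[of "2 :: nat" "card (types A)"] by simp
    next
      case False
      obtain c B where B: "B \<subseteq> A" "connected_in (A - B) E a" "connected_in B E c"
        and cut: "\<And>x y. x \<in> A - B \<Longrightarrow> y \<in> B \<Longrightarrow> E x y \<Longrightarrow> x = a \<and> y = c"
        by (rule connected_in_split[OF G(1,3) psubset.prems(1,2) False]) blast
      have parts: "a \<in> A - B" "c \<in> B" using B by (auto simp: connected_in_def)
      have fewer: "2 * 2 ^ card (types C) \<le> (2 :: nat) ^ card (types A)" if "C \<subset> A" for C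
      proof -
        have "ef_type k A E [a] \<noteq> ef_type k B E [b]" if "B \<subseteq> C" "b \<in> B" for B b
          using that \<open>C \<subset> A\<close>
          by (intro defines_graph_imp_ef_type_neq[OF G(1,2) p psubset.prems(1) a psubset.prems(3)]) auto
        then have "ef_type k A E [a] \<notin> types C" unfolding types_def by blast
        moreover have "types C \<subseteq> types A" using that unfolding types_def by blast
        ultimately have "card (types C) < card (types A)"
          using own fin by (intro psubset_card_mono) auto
        then have "Suc (card (types C)) \<le> card (types A)" by simp
        then have "(2 :: nat) ^ Suc (card (types C)) \<le> 2 ^ card (types A)"
          by (rule power_increasing) simp
        then show ?thesis by simp
      qed
      have sub: "A - B \<subset> A" "B \<subset> A" using parts B by auto
      have "card (A - B) < 2 ^ card (types (A - B))"
      proof (rule psubset.IH[OF sub(1)])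
        show "y = a" if "x \<in> V - (A - B)" "y \<in> A - B" "E x y" for x y
          using that psubset.prems(3) cut sym by blast
      qed (use psubset.prems B in auto)
      moreover have "card B < 2 ^ card (types B)"
      proof (rule psubset.IH[OF sub(2)])
        \<comment> \<open>An edge entering \<open>B\<close> from outside \<open>A\<close> would end
          in \<open>a\<close>, which is not in \<open>B\<close>; one from \<open>A - B\<close> is
          the cut edge.\<close>
        show "y = c" if "x \<in> V - B" "y \<in> B" "E x y" for x y
          using that psubset.prems(3) cut parts B(1) by blast
      qed (use psubset.prems B in auto)
      moreover have "card A = card (A - B) + card B"
        using psubset.hyps B(1) by (simp add: card_Diff_subset finite_subset card_mono)
      ultimately show ?thesis using fewer[OF sub(1)] fewer[OF sub(2)] by linarith
    qed
  qed
  obtain a where a: "a \<in> V" using G(1) unfolding is_graph_def by blast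
  have "connected_in V E a"
  proof -
    have "(\<lambda>u v. u \<in> V \<and> v \<in> V \<and> E u v) = E"
      using G(1) unfolding is_graph_def by (intro ext) blast
    then show ?thesis
      using T a by (simp add: is_tree_def connected_graph_def connected_in_def)
  qed
  \<comment> \<open>For \<open>A = V\<close> the pendant condition is vacuous.\<close>
  then have "card V < 2 ^ card (types V)" using small[OF G(2)] by simp
  also have "card (types V) \<le> ?N" using card_mono[OF _ types_sub] by simp
  then have "2 ^ card (types V) \<le> (2 :: nat) ^ ?N" by (rule power_increasing) simp
  finally show ?thesis by simp
qed

section \<open>Finite graphs are definable\<close>

text \<open>The empty conjunction is a closed valid formula, so it adds no free variables.\<close>

fun conjs :: "fo list \<Rightarrow> fo" where
  "conjs [] = Neg (Ex 0 (Neg (Eq 0 0)))"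
| "conjs (p # ps) = Conj p (conjs ps)"

fun exs :: "nat \<Rightarrow> fo \<Rightarrow> fo" where
  "exs 0 p = p"
| "exs (Suc n) p = Ex n (exs n p)"

definition literal :: "bool \<Rightarrow> fo \<Rightarrow> fo" where
  "literal b p = (if b then p else Neg p)"

lemma sat_conjs [simp]: "sat V E s (conjs ps) \<longleftrightarrow> (\<forall>p\<in>set ps. sat V E s p)"
  by (induction ps) auto

lemma fv_conjs [simp]: "fv (conjs ps) = (\<Union>p\<in>set ps. fv p)"
  by (induction ps) auto

lemma fv_exs [simp]: "fv (exs n p) = fv p - {..<n}"
proof (induction n)
  case (Suc n)
  have "fv (exs (Suc n) p) = fv p - {..<n} - {n}" by (simp only: exs.simps fv.simps Suc.IH)
  also have "\<dots> = fv p - {..<Suc n}" by auto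
  finally show ?case .
qed simp

lemma sat_literal [simp]: "sat V E s (literal b p) \<longleftrightarrow> (sat V E s p \<longleftrightarrow> b)"
  by (simp add: literal_def)

lemma fv_literal [simp]: "fv (literal b p) = fv p"
  by (simp add: literal_def)

lemma sat_exs:
  "sat V E s (exs n p) \<longleftrightarrow> (\<exists>f. (\<forall>i<n. f i \<in> V) \<and> sat V E (\<lambda>i. if i < n then f i else s i) p)"
proof (induction n arbitrary: s)
  case 0
  then show ?case by simp
next
  case (Suc n)
  have upd: "(\<lambda>i. if i < n then f i else (s(n := v)) i) =
      (\<lambda>i. if i < Suc n then (f(n := v)) i else s i)" for f v
    by (auto simp: less_Suc_eq)
  show ?case
  proof
    assume "sat V E s (exs (Suc n) p)"
    then obtain v f where vf: "v \<in> V" "\<forall>i<n. f i \<in> V"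
      "sat V E (\<lambda>i. if i < n then f i else (s(n := v)) i) p"
      by (auto simp: Suc.IH)
    have "\<forall>i<Suc n. (f(n := v)) i \<in> V" using vf(1,2) by (auto simp: less_Suc_eq)
    then show "\<exists>f. (\<forall>i<Suc n. f i \<in> V) \<and> sat V E (\<lambda>i. if i < Suc n then f i else s i) p"
      using vf(3) unfolding upd by blast
  next
    assume "\<exists>f. (\<forall>i<Suc n. f i \<in> V) \<and> sat V E (\<lambda>i. if i < Suc n then f i else s i) p"
    then obtain f where f: "\<forall>i<Suc n. f i \<in> V" "sat V E (\<lambda>i. if i < Suc n then f i else s i) p"
      by blast
    then have "sat V E (\<lambda>i. if i < n then f i else (s(n := f n)) i) p"
      unfolding upd by (simp only: fun_upd_triv)
    moreover have "\<forall>i<n. f i \<in> V" "f n \<in> V" using f(1) by auto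
    ultimately show "sat V E s (exs (Suc n) p)" unfolding exs.simps sat.simps Suc.IH by blast
  qed
qed

text \<open>Variables below \<open>n\<close> name the vertices, and variable \<open>n\<close> serves
  to say that there are no others. The large rank is harmless, as only the existence of a defining
  sentence matters.\<close>

definition diagram :: "nat \<Rightarrow> (nat \<Rightarrow> nat \<Rightarrow> bool) \<Rightarrow> fo" where
  "diagram n P = exs n (Conj
     (conjs [Conj (literal (P i j) (Adj i j)) (literal (i = j) (Eq i j)). i \<leftarrow> [0..<n], j \<leftarrow> [0..<n]])
     (Neg (Ex n (conjs [Neg (Eq n i). i \<leftarrow> [0..<n]]))))"

lemma sentence_diagram: "sentence (diagram n P)"
proof -
  have "fv (conjs [Conj (literal (P i j) (Adj i j)) (literal (i = j) (Eq i j)).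
      i \<leftarrow> [0..<n], j \<leftarrow> [0..<n]]) \<subseteq> {..<n}"
    by auto
  moreover have "fv (Neg (Ex n (conjs [Neg (Eq n i). i \<leftarrow> [0..<n]]))) \<subseteq> {..<n}"
    by auto
  ultimately show ?thesis
    unfolding sentence_def diagram_def fv_exs fv.simps(4) by blast
qed

lemma sat_diagram:
  "sat V E s (diagram n P) \<longleftrightarrow> (\<exists>f. bij_betw f {..<n} V \<and> (\<forall>i<n. \<forall>j<n. E (f i) (f j) \<longleftrightarrow> P i j))"
  (is "_ \<longleftrightarrow> ?R")
proof -
  have atoms: "sat V E t (conjs [Conj (literal (P i j) (Adj i j)) (literal (i = j) (Eq i j)).
      i \<leftarrow> [0..<n], j \<leftarrow> [0..<n]]) \<longleftrightarrow>
    (\<forall>i<n. \<forall>j<n. (E (t i) (t j) \<longleftrightarrow> P i j) \<and> (t i = t j \<longleftrightarrow> i = j))" for t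
    by auto
  have all: "sat V E t (Neg (Ex n (conjs [Neg (Eq n i). i \<leftarrow> [0..<n]]))) \<longleftrightarrow>
    (\<forall>v\<in>V. \<exists>i<n. v = t i)" for t
    by (auto simp: Bex_def)
  have "sat V E s (diagram n P) \<longleftrightarrow> (\<exists>f. (\<forall>i<n. f i \<in> V) \<and>
    (\<forall>i<n. \<forall>j<n. (E (f i) (f j) \<longleftrightarrow> P i j) \<and> (f i = f j \<longleftrightarrow> i = j)) \<and> (\<forall>v\<in>V. \<exists>i<n. v = f i))"
    unfolding diagram_def sat_exs sat.simps(4) atoms all by (intro ex_cong1) auto
  also have "\<dots> \<longleftrightarrow> ?R"
    by (intro ex_cong1) (auto simp: bij_betw_def inj_on_def)
  finally show ?thesis .
qed

lemma finite_graph_definable: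
  assumes "is_graph V E" "finite V"
  obtains p where "defines_graph V E p"
proof -
  obtain n g where g: "bij_betw g {..<n :: nat} V"
    using assms(2) by (metis ex_bij_betw_nat_finite lessThan_atLeast0)
  define p where "p = diagram n (\<lambda>i j. E (g i) (g j))"
  have "models V E p"
    unfolding models_def p_def sat_diagram using g by (intro allI impI exI[of _ g]) simp
  moreover have "graph_iso V E W F" if W: "is_graph W F" "models W F p" for W :: "nat set" and F
  proof -
    obtain w where "w \<in> W" using W(1) unfolding is_graph_def by blast
    then have "sat W F (\<lambda>_. w) p" using W(2) unfolding models_def by simp
    then obtain f where f: "bij_betw f {..<n} W"
      "\<And>i j. i < n \<Longrightarrow> j < n \<Longrightarrow> F (f i) (f j) \<longleftrightarrow> E (g i) (g j)"
      unfolding p_def sat_diagram by blast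
    define h where "h = inv_into {..<n} g"
    have h: "bij_betw h V {..<n}" unfolding h_def using g by (rule bij_betw_inv_into)
    have "g (h x) = x" "h x < n" if "x \<in> V" for x
      using that g h bij_betw_inv_into_right[OF g] by (auto simp: h_def bij_betw_def)
    then have "\<forall>x\<in>V. \<forall>y\<in>V. E x y \<longleftrightarrow> F ((f \<circ> h) x) ((f \<circ> h) y)" using f(2) by simp
    then show ?thesis
      unfolding graph_iso_def using bij_betw_trans[OF h f(1)] by blast
  qed
  ultimately have "defines_graph V E p"
    unfolding defines_graph_def using sentence_diagram p_def by blast
  then show thesis by (rule that)
qed

section \<open>The minima in \<open>D\<close> and \<open>q_trees\<close> are attained\<close>

lemma D_witness:
  assumes "is_graph V E" "finite V"
  obtains p where "qr p = D V E" "defines_graph V E p"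
proof -
  have "\<exists>k p. qr p = k \<and> defines_graph V E p"
    using finite_graph_definable[OF assms] by metis
  from LeastI_ex[OF this] show thesis
    using that unfolding D_def by blast
qed

definition star_adj :: "nat \<Rightarrow> nat \<Rightarrow> nat \<Rightarrow> bool" where
  "star_adj n x y \<longleftrightarrow> x < n \<and> y < n \<and> (x = 0 \<longleftrightarrow> y \<noteq> 0)"

text \<open>Stars show that the infimum in \<open>q_trees\<close> is over a nonempty set, hence
  attained.\<close>

lemma star_is_tree:
  assumes "n \<ge> 1"
  shows "is_tree {..<n} (star_adj n)"
proof -
  have "(star_adj n)\<^sup>*\<^sup>* x y" if "x < n" "y < n" for x y
  proof -
    have "(star_adj n)\<^sup>*\<^sup>* x 0" using that by (cases "x = 0") (auto simp: star_adj_def)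
    moreover have "(star_adj n)\<^sup>*\<^sup>* 0 y" using that by (cases "y = 0") (auto simp: star_adj_def)
    ultimately show ?thesis by (rule rtranclp_trans)
  qed
  moreover have "\<not> has_cycle {..<n} (star_adj n)"
  proof
    assume "has_cycle {..<n} (star_adj n)"
    then obtain vs where vs: "length vs \<ge> 3" "distinct vs" "star_adj n (last vs) (hd vs)"
      and step: "\<forall>i. Suc i < length vs \<longrightarrow> star_adj n (vs ! i) (vs ! Suc i)"
      unfolding has_cycle_def by blast
    obtain x y z us where us: "vs = x # y # z # us"
      using vs(1) by (metis Suc_le_length_iff numeral_3_eq_3)
    \<comment> \<open>Every edge has exactly one end at the centre 0. Distinctness of
      \<open>x\<close> and \<open>z\<close> makes \<open>y\<close> the centre; the closing edge then
      makes the last vertex the centre as well, a repetition.\<close>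
    have "x = 0 \<longleftrightarrow> y \<noteq> 0" "y = 0 \<longleftrightarrow> z \<noteq> 0"
      using step[rule_format, of 0] step[rule_format, of 1] by (auto simp: us star_adj_def)
    then have y: "y = 0" using vs(2) us by auto
    then have "x \<noteq> 0" using vs(2) us by auto
    then have "last (z # us) = 0" using vs(3) us by (simp add: star_adj_def)
    then have "y \<in> set (z # us)" using y last_in_set[of "z # us"] by simp
    then show False using vs(2) us by simp
  qed
  ultimately show ?thesis
    using assms by (auto simp: is_tree_def is_graph_def connected_graph_def star_adj_def lessThan_empty_iff)
qed

lemma q_trees_witness:
  assumes "n \<ge> 1"
  obtains V :: "nat set" and E where "is_tree V E" "card V = n" "q_trees n = D V E"
proof -
  let ?S = "{(V :: nat set, E). is_tree V E \<and> card V = n}"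
  have "?S \<noteq> {}" using star_is_tree[OF assms] by (auto intro!: exI[of _ "{..<n}"])
  then have "q_trees n \<in> (\<lambda>VE. D (fst VE) (snd VE)) ` ?S"
    unfolding q_trees_def by (intro Inf_nat_def1) blast
  then show thesis using that by auto
qed

section \<open>The iterated logarithm\<close>

lemma le_tower: "n \<le> tower n"
proof (induction n)
  case (Suc n)
  then have "n < 2 ^ tower n" using less_exp le_less_trans by blast
  then show ?case by simp
qed simp

lemma le_tower_log_star: "n \<le> tower (log_star n)"
  unfolding log_star_def using le_tower by (rule LeastI)

lemma log_star_le: "n \<le> tower i \<Longrightarrow> log_star n \<le> i"
  unfolding log_star_def by (rule Least_le)

lemma log_star_mono: "m \<le> n \<Longrightarrow> log_star m \<le> log_star n"
  by (rule log_star_le) (use le_tower_log_star[of n] in simp)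

lemma funpow_exp_tower:
  assumes "x \<le> tower i"
  shows "((\<lambda>x. 2 ^ x) ^^ j) x \<le> tower (j + i)"
  using assms by (induction j) (auto intro: power_increasing)

text \<open>Four further levels generously absorb the quadratic polynomial:
  \<open>8 * (Suc k)\<^sup>2\<close> is at most \<open>2 ^ (3 + 2 * t)\<close> with
  \<open>t = tower i\<close>.\<close>

lemma square_le_tower:
  assumes "k \<le> tower i"
  shows "8 * (Suc k)\<^sup>2 \<le> tower (4 + i)"
proof -
  define t where "t = tower i"
  have t: "t \<ge> 1" unfolding t_def by (cases i) auto
  have exp: "Suc m \<le> 2 ^ m" for m :: nat using less_exp[of m] by (rule Suc_leI)
  have "Suc k \<le> 2 ^ t" using assms exp[of t] by (simp add: t_def)
  then have "8 * (Suc k)\<^sup>2 \<le> 8 * (2 ^ t)\<^sup>2" by (intro mult_left_mono power_mono) auto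
  also have "\<dots> = 2 ^ (3 + 2 * t)" by (simp add: power_add power_mult[symmetric] mult.commute)
  also have "\<dots> \<le> 2 ^ 2 ^ 2 ^ 2 ^ t"
  proof (intro power_increasing)
    have "3 + 2 * t \<le> 4 * Suc t" by simp
    also have "\<dots> \<le> 4 * 2 ^ t" using exp[of t] by simp
    also have "\<dots> = 2 ^ (2 + t)" by (simp add: power_add)
    also have "\<dots> \<le> 2 ^ 2 ^ 2 ^ t"
    proof (intro power_increasing)
      have "2 \<le> (2 :: nat) ^ t" using power_increasing[OF t, of "2 :: nat"] by simp
      then have "2 + t \<le> Suc (2 ^ t)" using exp[of t] by simp
      also have "\<dots> \<le> 2 ^ 2 ^ t" by (rule exp)
      finally show "2 + t \<le> 2 ^ 2 ^ t" .
    qed simp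
    finally show "3 + 2 * t \<le> 2 ^ 2 ^ 2 ^ t" .
  qed simp
  also have "4 + i = Suc (Suc (Suc (Suc i)))" by simp
  then have "2 ^ 2 ^ 2 ^ 2 ^ t = tower (4 + i)" by (simp only: tower.simps t_def)
  finally show ?thesis .
qed

theorem theorem8p1:
  shows "\<exists>C::real. \<forall>n::nat. n \<ge> 1 \<longrightarrow>
           real (q_trees n) \<ge> real (log_star n) - real (log_star (log_star n)) - C"
proof (intro exI[of _ 6] allI impI)
  fix n :: nat
  assume "n \<ge> 1"
  define k where "k = q_trees n"
  obtain V :: "nat set" and E where T: "is_tree V E" "card V = n" "q_trees n = D V E"
    using q_trees_witness[OF \<open>n \<ge> 1\<close>] .
  then obtain p where "qr p = k" "defines_graph V E p"
    unfolding k_def is_tree_def using D_witness by metis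
  then have "n < ((\<lambda>x. 2 ^ x) ^^ Suc (Suc k)) (8 * (Suc k)\<^sup>2)"
    using tree_card_less[OF T(1)] T(2) by blast
  \<comment> \<open>The constant 6 arises here: two levels from \<open>tree_card_less\<close> beyond
    \<open>k\<close>, and four from \<open>square_le_tower\<close>.\<close>
  also have "\<dots> \<le> tower (Suc (Suc k) + (4 + log_star k))"
    by (intro funpow_exp_tower square_le_tower le_tower_log_star)
  finally have bound: "log_star n \<le> k + log_star k + 6"
    using log_star_le[of n "Suc (Suc k) + (4 + log_star k)"] by simp
  show "real (q_trees n) \<ge> real (log_star n) - real (log_star (log_star n)) - 6"
  \<comment> \<open>If \<open>k \<le> log_star n\<close>, monotonicity replaces
    \<open>log_star k\<close> by \<open>log_star (log_star n)\<close>; otherwise \<open>k\<close>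
    alone exceeds \<open>log_star n\<close>.\<close>
  proof (cases "k \<le> log_star n")
    case True
    then show ?thesis using bound log_star_mono[OF True] by (simp add: k_def)
  next
    case False
    then show ?thesis by (simp add: k_def)
  qed
qed

end
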